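(* Let $\mathcal{H}$ be a connected $r$-uniform hypergraph on $n$ vertices whose longest Berge path has length $k$, where $k>r\ge3$. Then there is a good set $S$ of $\mathcal{H}$ such that either $|S|<n$ or $n=k+1$. In particular $\mathcal{S}_r(\mathcal{H})\ne\emptyset$.
   Context: Hypergraphs are simple. A Berge path of length $k$ is an alternating sequence $v_0e_1v_1\cdots v_{k-1}e_kv_k$ of distinct vertices and distinct edges with $v_{i-1},v_i\in e_i$. Connected means every two distinct vertices are joined by a Berge path. $p_{\mathcal{H}}(e)$ is the maximum length of a Berge path having $e$ as a defining edge. For $S\subseteq V(\mathcal{H})$, $N(S)=\{e\in E(\mathcal{H}):e\cap S\neq\emptyset\}$. For real $x\ge1$, $f_r(x)=\frac1r$ if $x=1$, $\frac{x}{r+1}$ if $1<x\le r-1$, $\frac1r\binom{x}{r-1}$ if $x\ge r$. If the longest Berge path of $\mathcal{H}$ has length $k$, a good set is a nonempty $S\subseteq V(\mathcal{H})$ with $p_{\mathcal{H}}(e)=k$ for all $e\in N(S)$ and $|N(S)|\le f_r(k)|S|$; $\mathcal{S}_r(\mathcal{H})$ is the family of all good sets. *)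

theory Defs
  imports Complex_Main
begin

text \<open>A hypergraph has a finite vertex set \<open>V\<close> and a set of edges \<open>E\<close>, each a subset of \<open>V\<close>;
  it is simple because \<open>E\<close> is a set.\<close>

definition hypergraph :: "'a set \<Rightarrow> 'a set set \<Rightarrow> bool" where
  "hypergraph V E \<longleftrightarrow> finite V \<and> (\<forall>e\<in>E. e \<subseteq> V)"

definition uniform_hypergraph :: "nat \<Rightarrow> 'a set \<Rightarrow> 'a set set \<Rightarrow> bool" where
  "uniform_hypergraph r V E \<longleftrightarrow> hypergraph V E \<and> (\<forall>e\<in>E. card e = r)"

text \<open>The path $v_0 e_1 v_1 \cdots e_k v_k$ is given by the lists \<open>vs\<close> $= [v_0,\dots,v_k]$ and
  \<open>es\<close> $= [e_1,\dots,e_k]$, so that \<open>es ! i\<close> is $e_{i+1}$. Its length is \<open>length es\<close>, and a single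
  vertex is a path of length 0.\<close>

definition berge_path :: "'a set \<Rightarrow> 'a set set \<Rightarrow> 'a list \<Rightarrow> 'a set list \<Rightarrow> bool" where
  "berge_path V E vs es \<longleftrightarrow>
     length vs = length es + 1 \<and> distinct vs \<and> distinct es \<and> set vs \<subseteq> V \<and> set es \<subseteq> E \<and>
     (\<forall>i<length es. vs ! i \<in> es ! i \<and> vs ! (i + 1) \<in> es ! i)"

definition connected_hypergraph :: "'a set \<Rightarrow> 'a set set \<Rightarrow> bool" where
  "connected_hypergraph V E \<longleftrightarrow>
     (\<forall>u\<in>V. \<forall>w\<in>V. u \<noteq> w \<longrightarrow> (\<exists>vs es. berge_path V E vs es \<and> hd vs = u \<and> last vs = w))"

text \<open>On \<^typ>\<open>nat\<close>, \<open>Sup\<close> is the maximum of a nonempty finite set, and the supremum of the empty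
  set is 0. All path lengths in a hypergraph are smaller than the number of its vertices.\<close>

definition longest_path_length :: "'a set \<Rightarrow> 'a set set \<Rightarrow> nat" where
  "longest_path_length V E = Sup {length es |vs es. berge_path V E vs es}"

definition edge_path_length :: "'a set \<Rightarrow> 'a set set \<Rightarrow> 'a set \<Rightarrow> nat" where
  "edge_path_length V E e = Sup {length es |vs es. berge_path V E vs es \<and> e \<in> set es}"

definition incident_edges :: "'a set set \<Rightarrow> 'a set \<Rightarrow> 'a set set" where
  "incident_edges E S = {e \<in> E. e \<inter> S \<noteq> {}}"

text \<open>The function is left unspecified where it has no prescribed value: for $x < 1$ and in the gap
  $r - 1 < x < r$.\<close>

definition f_bound :: "nat \<Rightarrow> real \<Rightarrow> real" where
  "f_bound r x =
     (if x = 1 then 1 / real r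
      else if 1 < x \<and> x \<le> real r - 1 then x / (real r + 1)
      else if x \<ge> 1 \<and> x \<ge> real r then 1 / real r * (x gchoose (r - 1))
      else undefined)"

definition good_set :: "nat \<Rightarrow> 'a set \<Rightarrow> 'a set set \<Rightarrow> 'a set \<Rightarrow> bool" where
  "good_set r V E S \<longleftrightarrow>
     S \<noteq> {} \<and> S \<subseteq> V \<and>
     (\<forall>e\<in>incident_edges E S. edge_path_length V E e = longest_path_length V E) \<and>
     real (card (incident_edges E S)) \<le> f_bound r (real (longest_path_length V E)) * real (card S)"

definition good_sets :: "nat \<Rightarrow> 'a set \<Rightarrow> 'a set set \<Rightarrow> 'a set set" where
  "good_sets r V E = {S. good_set r V E S}"

end

theory Submission
  imports Defs
begin

text \<open>If the two ends of a longest path lie in a common edge off the path, there is a Berge cycle of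
  length \<open>k + 1\<close>. By connectedness and maximality it spans \<open>V\<close>, so \<open>n = k + 1\<close>, every vertex ends a
  longest path, and \<open>S = V\<close> works by counting all \<open>r\<close>-subsets.

  Otherwise let \<open>S\<close> consist of ends of longest paths: every edge at such an end lies on a longest path,
  by a Posa rotation. The neighbours of the two ends through edges off the path occupy at most \<open>k\<close>
  positions altogether, as a crossing pair would give a cycle. Choose a longest path whose
  first vertex has the most such neighbours; then the last vertex of every longest path with the same
  first vertex and the same edges has at most \<open>k div 2\<close> of them. Among these paths, let the last
  vertex lie in the largest possible number \<open>d\<close> of path edges. Rotating along these edges yields \<open>d\<close>
  ends, and they meet at most \<open>min k (d * d)\<close> path edges and \<open>d * (k div 2 choose (r - 1))\<close> others.
  This suffices unless \<open>r = 3\<close> and \<open>k = 4\<close>. There, if every end has degree at least 3, an edge off the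
  path at an end would determine enough edges to produce a 5-cycle; so all edges at the ends are
  path edges, and the at least three ends obtained by rotation meet at most four edges.\<close>

subsection \<open>Operations on Berge paths\<close>

lemma berge_path_length: "berge_path V E vs es \<Longrightarrow> length vs = length es + 1"
  by (simp add: berge_path_def)

lemma berge_path_nonempty: "berge_path V E vs es \<Longrightarrow> vs \<noteq> []"
  by (auto simp: berge_path_def)

lemma berge_path_hd: "berge_path V E vs es \<Longrightarrow> hd vs = vs ! 0"
  by (simp add: hd_conv_nth berge_path_nonempty)

lemma berge_path_last: "berge_path V E vs es \<Longrightarrow> last vs = vs ! length es"
  by (simp add: last_conv_nth berge_path_nonempty berge_path_length)

lemma berge_path_rev:
  assumes "berge_path V E vs es"
  shows "berge_path V E (rev vs) (rev es)"
proof -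
  have len: "length vs = length es + 1" using assms by (simp add: berge_path_def)
  have "rev vs ! i \<in> rev es ! i \<and> rev vs ! (i + 1) \<in> rev es ! i" if "i < length es" for i
  proof -
    have "length es - Suc i < length es" using that by simp
    then have "vs ! (length es - Suc i) \<in> es ! (length es - Suc i)"
      "vs ! (length es - Suc i + 1) \<in> es ! (length es - Suc i)"
      using assms by (auto simp: berge_path_def)
    moreover have "length es - Suc i + 1 = length es - i" using that by simp
    ultimately show ?thesis using that by (simp add: rev_nth len)
  qed
  then show ?thesis using assms by (simp add: berge_path_def)
qed

lemma berge_path_take:
  assumes "berge_path V E vs es" "j \<le> length es"
  shows "berge_path V E (take (j + 1) vs) (take j es)"
  using assms set_take_subset[of j es] set_take_subset[of "j + 1" vs]
  by (auto simp: berge_path_def min_def)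

lemma berge_path_drop:
  assumes "berge_path V E vs es" "j \<le> length es"
  shows "berge_path V E (drop j vs) (drop j es)"
  using assms set_drop_subset[of j es] set_drop_subset[of j vs]
  by (auto simp: berge_path_def)

text \<open>All path surgery below is an instance of this gluing. The new edge \<open>g\<close> sits
  at index \<open>length es\<close>, which separates the three cases.\<close>

lemma berge_path_append:
  assumes p: "berge_path V E vs es" and q: "berge_path V E ws fs"
    and disj: "set vs \<inter> set ws = {}" "set es \<inter> set fs = {}"
    and g: "g \<in> E" "g \<notin> set es" "g \<notin> set fs" "last vs \<in> g" "hd ws \<in> g"
  shows "berge_path V E (vs @ ws) (es @ g # fs)"
proof -
  have len: "length vs = length es + 1" "length ws = length fs + 1"
    using p q by (auto simp: berge_path_def)
  have "(vs @ ws) ! i \<in> (es @ g # fs) ! i \<and> (vs @ ws) ! (i + 1) \<in> (es @ g # fs) ! i"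
    if "i < length (es @ g # fs)" for i
  proof -
    consider "i < length es" | "i = length es" | "i > length es" by linarith
    then show ?thesis
    proof cases
      case 1
      then show ?thesis using p len by (simp add: nth_append berge_path_def)
    next
      case 2
      then show ?thesis
        using g(4,5) berge_path_last[OF p] berge_path_hd[OF q] len by (simp add: nth_append)
    next
      case 3
      define j where "j = i - Suc (length es)"
      have "i = Suc (length es) + j" "j < length fs" using 3 that by (auto simp: j_def)
      then show ?thesis using q len by (simp add: nth_append berge_path_def)
    qed
  qed
  then show ?thesis using assms by (simp add: berge_path_def)
qed

lemma berge_path_singleton: "v \<in> V \<Longrightarrow> berge_path V E [v] []"
  by (simp add: berge_path_def)

lemma distinct_set_split:
  assumes "distinct xs" "j < length xs"
  shows "set (take j xs) \<inter> set (drop (Suc j) xs) = {}"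
    and "set (take j xs) \<union> set (drop (Suc j) xs) = set xs - {xs ! j}"
proof -
  have "xs = take j xs @ xs ! j # drop (Suc j) xs" using assms by (simp add: id_take_nth_drop)
  then have d: "distinct (take j xs @ xs ! j # drop (Suc j) xs)"
    and s: "set xs = set (take j xs @ xs ! j # drop (Suc j) xs)"
    using assms(1) by metis+
  show "set (take j xs) \<inter> set (drop (Suc j) xs) = {}" using d by auto
  show "set (take j xs) \<union> set (drop (Suc j) xs) = set xs - {xs ! j}"
    unfolding s using d by auto
qed

lemma take_drop_disjoint: "distinct xs \<Longrightarrow> set (take j xs) \<inter> set (drop j xs) = {}"
  using set_take_disj_set_drop_if_distinct[of xs j j] by simp

text \<open>Taking \<open>g = es ! j\<close> is allowed: then the new path uses the same edges.\<close>

lemma berge_path_posa_rotation: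
  assumes p: "berge_path V E vs es" and j: "j < length es"
    and g: "g \<in> E" "g \<notin> set es - {es ! j}" "last vs \<in> g" "vs ! j \<in> g"
  obtains vs' es' where "berge_path V E vs' es'" "length es' = length es" "hd vs' = hd vs"
    "last vs' = vs ! (j + 1)" "set vs' = set vs" "set es' = insert g (set es - {es ! j})"
proof
  \<comment> \<open>The new path runs v_0, ..., v_j, crosses \<open>g\<close> to v_k, and goes back
    down to v_{j+1}.\<close>
  let ?vs = "take (j + 1) vs @ rev (drop (j + 1) vs)"
  let ?es = "take j es @ g # rev (drop (j + 1) es)"
  have len: "length vs = length es + 1" and dist: "distinct vs" "distinct es"
    using p by (auto simp: berge_path_def)
  note es = distinct_set_split[OF dist(2) j]
  have p1: "berge_path V E (take (j + 1) vs) (take j es)"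
    using berge_path_take[OF p] j by simp
  have p2: "berge_path V E (rev (drop (j + 1) vs)) (rev (drop (j + 1) es))"
    using berge_path_rev[OF berge_path_drop[OF p]] j by simp
  have l: "last (take (j + 1) vs) = vs ! j"
    using berge_path_last[OF p1] j by (simp add: min_def)
  have ne: "drop (j + 1) vs \<noteq> []" using len j by simp
  have h: "hd (rev (drop (j + 1) vs)) = last vs"
    using ne by (simp add: hd_rev last_drop)
  show "berge_path V E ?vs ?es"
    using g l h es take_drop_disjoint[OF dist(1), of "j + 1"]
    by (intro berge_path_append[OF p1 p2]) auto
  show "length ?es = length es" using j by simp
  show "hd ?vs = hd vs" using len by (cases vs) auto
  show "last ?vs = vs ! (j + 1)"
    using ne len j by (simp add: last_append last_rev hd_drop_conv_nth)
  have "set ?vs = set (take (j + 1) vs @ drop (j + 1) vs)" by (simp only: set_append set_rev)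
  then show "set ?vs = set vs" by (simp only: append_take_drop_id)
  show "set ?es = insert g (set es - {es ! j})" using es(2) by auto
qed

text \<open>\<open>g\<close> closes the path to a cycle; cutting it at \<open>es ! j\<close> instead
  leaves v_{j+1}, ..., v_k, v_0, ..., v_j.\<close>

lemma berge_path_cycle_rotation:
  assumes p: "berge_path V E vs es" and j: "j < length es"
    and g: "g \<in> E" "g \<notin> set es" "last vs \<in> g" "hd vs \<in> g"
  obtains vs' es' where "berge_path V E vs' es'" "length es' = length es" "hd vs' = vs ! (j + 1)"
    "last vs' = vs ! j" "set vs' = set vs" "set es' = insert g (set es - {es ! j})"
proof
  let ?vs = "drop (j + 1) vs @ take (j + 1) vs"
  let ?es = "drop (j + 1) es @ g # take j es"
  have len: "length vs = length es + 1" and dist: "distinct vs" "distinct es"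
    using p by (auto simp: berge_path_def)
  note es = distinct_set_split[OF dist(2) j]
  have p1: "berge_path V E (take (j + 1) vs) (take j es)"
    using berge_path_take[OF p] j by simp
  have p2: "berge_path V E (drop (j + 1) vs) (drop (j + 1) es)"
    using berge_path_drop[OF p] j by simp
  have ne: "drop (j + 1) vs \<noteq> []" "take (j + 1) vs \<noteq> []" using len j by auto
  have h: "hd (take (j + 1) vs) = hd vs" "last (drop (j + 1) vs) = last vs"
    using ne by (auto simp: last_drop hd_take)
  show "berge_path V E ?vs ?es"
    using g h es take_drop_disjoint[OF dist(1), of "j + 1"]
    by (intro berge_path_append[OF p2 p1]) auto
  show "length ?es = length es" using j by simp
  show "hd ?vs = vs ! (j + 1)"
    using ne len j by (simp add: hd_append hd_drop_conv_nth)
  have "last ?vs = last (take (j + 1) vs)" using ne by (simp add: last_append)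
  then show "last ?vs = vs ! j"
    using berge_path_last[OF p1] j by (simp add: min_def)
  have "set ?vs = set (take (j + 1) vs @ drop (j + 1) vs)" by (simp only: set_append Un_commute)
  then show "set ?vs = set vs" by (simp only: append_take_drop_id)
  show "set ?es = insert g (set es - {es ! j})" using es(2) by auto
qed

text \<open>Some step of the path leaves \<open>A\<close>, and the edge of that step meets both
  sides. This is how connectedness enters.\<close>

lemma berge_path_leaves:
  assumes "berge_path V E vs es" "hd vs \<in> A" "last vs \<notin> A"
  shows "\<exists>h\<in>E. h \<inter> A \<noteq> {} \<and> \<not> h \<subseteq> A"
proof -
  have "\<exists>i<length es. vs ! i \<in> A \<and> vs ! Suc i \<notin> A"
  proof (rule ccontr)
    assume "\<not> ?thesis"
    then have step: "i < length es \<Longrightarrow> vs ! i \<in> A \<Longrightarrow> vs ! Suc i \<in> A" for i by blast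
    have "i \<le> length es \<Longrightarrow> vs ! i \<in> A" for i
    proof (induction i)
      case 0
      then show ?case using assms(2) berge_path_hd[OF assms(1)] by simp
    next
      case (Suc i)
      then show ?case using step by simp
    qed
    then show False using assms(3) berge_path_last[OF assms(1)] by simp
  qed
  then obtain i where i: "i < length es" "vs ! i \<in> A" "vs ! Suc i \<notin> A" by blast
  then have "es ! i \<in> E" "vs ! i \<in> es ! i" "vs ! Suc i \<in> es ! i"
    using assms(1) nth_mem[of i es] by (auto simp: berge_path_def)
  then show ?thesis using i by blast
qed

subsection \<open>Longest Berge paths\<close>

text \<open>\<open>F\<close> will be the edge set of a longest path and \<open>x\<close> an end of
  it. The path enters only through \<open>F\<close>, so rotations that keep \<open>F\<close> and
  \<open>x\<close> do not affect this set.\<close>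

definition private_nbrs :: "'a set set \<Rightarrow> 'a set set \<Rightarrow> 'a \<Rightarrow> 'a set" where
  "private_nbrs E F x = \<Union>{g \<in> E - F. x \<in> g} - {x}"

lemma mem_private_nbrs: "y \<in> private_nbrs E F x \<longleftrightarrow> y \<noteq> x \<and> (\<exists>g\<in>E - F. x \<in> g \<and> y \<in> g)"
  by (auto simp: private_nbrs_def)

text \<open>Here \<open>k\<close> only bounds all lengths; that it is attained enters through
  hypotheses \<open>longest vs es\<close>.\<close>

locale longest_berge_paths =
  fixes r :: nat and V :: "'a set" and E :: "'a set set" and k :: nat
  assumes uniform: "uniform_hypergraph r V E"
    and bound: "berge_path V E vs es \<Longrightarrow> length es \<le> k"
    and r_ge_2: "r \<ge> 2" and k_pos: "k > 0"
begin

definition longest :: "'a list \<Rightarrow> 'a set list \<Rightarrow> bool" where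
  "longest vs es \<longleftrightarrow> berge_path V E vs es \<and> length es = k"

lemma finite_V: "finite V"
  and edge_subset: "e \<in> E \<Longrightarrow> e \<subseteq> V"
  and card_edge: "e \<in> E \<Longrightarrow> card e = r"
  using uniform by (auto simp: uniform_hypergraph_def hypergraph_def)

lemma finite_E: "finite E"
  using finite_subset[of E "Pow V"] finite_V edge_subset by blast

lemma finite_edge: "e \<in> E \<Longrightarrow> finite e"
  using edge_subset finite_V finite_subset by blast

lemma longest_berge: "longest vs es \<Longrightarrow> berge_path V E vs es"
  by (simp add: longest_def)

lemma longestD:
  assumes "longest vs es"
  shows "length es = k" "length vs = k + 1" "distinct vs" "distinct es" "set vs \<subseteq> V"
    "set es \<subseteq> E" "hd vs = vs ! 0" "last vs = vs ! k" "vs \<noteq> []"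
    "i < k \<Longrightarrow> vs ! i \<in> es ! i" "i < k \<Longrightarrow> vs ! (i + 1) \<in> es ! i" "i < k \<Longrightarrow> es ! i \<in> E"
  using assms berge_path_hd[of V E vs es] berge_path_last[of V E vs es]
  by (auto simp: longest_def berge_path_def)

lemma longest_rev: "longest vs es \<Longrightarrow> longest (rev vs) (rev es)"
  by (simp add: longest_def berge_path_rev)

lemma longest_posa_rotation:
  assumes p: "longest vs es" and j: "j < k"
    and g: "g \<in> E" "g \<notin> set es - {es ! j}" "last vs \<in> g" "vs ! j \<in> g"
  obtains vs' es' where "longest vs' es'" "hd vs' = hd vs"
    "last vs' = vs ! (j + 1)" "set vs' = set vs" "set es' = insert g (set es - {es ! j})"
proof -
  have "j < length es" using p j by (simp add: longest_def)
  from berge_path_posa_rotation[OF longest_berge[OF p] this g] obtain vs' es'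
    where "berge_path V E vs' es'" "length es' = length es" "hd vs' = hd vs"
    "last vs' = vs ! (j + 1)" "set vs' = set vs" "set es' = insert g (set es - {es ! j})"
    by blast
  moreover from this p have "longest vs' es'" by (simp add: longest_def)
  ultimately show thesis using that by blast
qed

lemma no_extension:
  assumes p: "longest vs es" and g: "g \<in> E" "g \<notin> set es" "last vs \<in> g"
  shows "g \<subseteq> set vs"
proof (rule ccontr)
  assume "\<not> g \<subseteq> set vs"
  then obtain y where y: "y \<in> g" "y \<notin> set vs" by blast
  then have "y \<in> V" using g edge_subset by blast
  then have "berge_path V E (vs @ [y]) (es @ g # [])"
    using y g by (intro berge_path_append[OF longest_berge[OF p] berge_path_singleton]) auto
  from bound[OF this] show False using longestD(1)[OF p] by simp
qed

lemma edge_path_length_eq: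
  assumes p: "longest vs es" and "e \<in> set es"
  shows "edge_path_length V E e = k"
  unfolding edge_path_length_def
  using assms bound by (intro cSup_eq_maximum) (auto simp: longest_def)

lemma longest_path_length_eq:
  assumes p: "longest vs es"
  shows "longest_path_length V E = k"
  unfolding longest_path_length_def
  using assms bound by (intro cSup_eq_maximum) (auto simp: longest_def)

text \<open>An edge off the path has a second vertex, which lies on the path by
  \<open>no_extension\<close>; rotating there brings the edge onto a longest path.\<close>

lemma edge_at_end:
  assumes p: "longest vs es" and e: "e \<in> E" "last vs \<in> e"
  shows "edge_path_length V E e = k"
proof (cases "e \<in> set es")
  case True
  then show ?thesis using p edge_path_length_eq by blast
next
  case False
  have "e \<noteq> {last vs}" using card_edge[OF e(1)] r_ge_2 by auto
  then obtain y where y: "y \<in> e" "y \<noteq> last vs" using e by blast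
  then have "y \<in> set vs" using no_extension[OF p e(1) False e(2)] by blast
  then obtain j where j: "j < k + 1" "vs ! j = y" using longestD(2)[OF p] by (metis in_set_conv_nth)
  then have "j \<noteq> k" using y longestD(8)[OF p] by metis
  then have "j < k" using j by simp
  have "e \<notin> set es - {es ! j}" "vs ! j \<in> e" using False y j by simp_all
  then obtain vs' es' where "longest vs' es'" "hd vs' = hd vs" "last vs' = vs ! (j + 1)"
    "set vs' = set vs" "set es' = insert e (set es - {es ! j})"
    by (rule longest_posa_rotation[OF p \<open>j < k\<close> e(1) _ e(2)])
  then show ?thesis using edge_path_length_eq[of vs' es' e] by simp
qed

definition ends :: "'a set" where
  "ends = {last vs |vs es. longest vs es}"

lemma endsE:
  assumes "x \<in> ends"
  obtains vs es where "longest vs es" "last vs = x"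
  using assms unfolding ends_def by blast

text \<open>For sets of ends, \<open>edge_at_end\<close> settles the condition on path lengths. The
  bound is cleared of denominators so that all counting stays in \<open>nat\<close>.\<close>

lemma good_setI:
  assumes S: "S \<noteq> {}" "S \<subseteq> ends" and "k \<ge> r"
    and card: "r * card (incident_edges E S) \<le> (k choose (r - 1)) * card S"
  shows "good_set r V E S"
proof -
  obtain vs es where p: "longest vs es" using S endsE by (metis equals0I subsetD)
  have L: "longest_path_length V E = k" using longest_path_length_eq[OF p] .
  have "S \<subseteq> V"
  proof
    fix x assume "x \<in> S"
    then obtain vs es where "longest vs es" "last vs = x" using S by (meson endsE subsetD)
    then show "x \<in> V" using longestD(5,9)[of vs es] last_in_set[of vs] by blast
  qed
  moreover have "edge_path_length V E e = k" if e: "e \<in> incident_edges E S" for e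
  proof -
    obtain x where x: "x \<in> S" "x \<in> e" "e \<in> E" using e by (auto simp: incident_edges_def)
    then obtain vs es where "longest vs es" "last vs = x"
      using S by (meson endsE subsetD)
    then show ?thesis using x edge_at_end by blast
  qed
  moreover have "real (card (incident_edges E S)) \<le> f_bound r (real k) * real (card S)"
  proof -
    have f: "f_bound r (real k) = real (k choose (r - 1)) / real r"
      using \<open>k \<ge> r\<close> r_ge_2 by (auto simp: f_bound_def binomial_gbinomial)
    have "real r * real (card (incident_edges E S)) \<le> real (k choose (r - 1)) * real (card S)"
      using card by (metis of_nat_le_iff of_nat_mult)
    then show ?thesis unfolding f using r_ge_2 by (simp add: pos_le_divide_eq mult.commute)
  qed
  ultimately show ?thesis using S L by (auto simp: good_set_def)
qed

text \<open>Closing a longest path by an edge gives a Berge cycle of length \<open>k + 1\<close>, on which every vertex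
  can be made the last one and every edge the closing one.\<close>

definition closes :: "'a list \<Rightarrow> 'a set list \<Rightarrow> 'a set \<Rightarrow> bool" where
  "closes vs es g \<longleftrightarrow> longest vs es \<and> g \<in> E \<and> g \<notin> set es \<and> hd vs \<in> g \<and> last vs \<in> g"

lemma closes_rotate:
  assumes c: "closes vs es g" and j: "j < k"
  obtains vs' es' where "closes vs' es' (es ! j)" "last vs' = vs ! j" "set vs' = set vs"
    "set es' = insert g (set es - {es ! j})"
proof -
  have p: "longest vs es" and g: "g \<in> E" "g \<notin> set es" "last vs \<in> g" "hd vs \<in> g"
    using c by (auto simp: closes_def)
  have j': "j < length es" using longestD(1)[OF p] j by simp
  obtain vs' es' where
    q: "berge_path V E vs' es'" "length es' = length es" "hd vs' = vs ! (j + 1)"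
    "last vs' = vs ! j" "set vs' = set vs" "set es' = insert g (set es - {es ! j})"
    by (rule berge_path_cycle_rotation[OF longest_berge[OF p] j' g])
  have "es ! j \<in> set es" using j' by simp
  then have "es ! j \<noteq> g" using g(2) by auto
  have "longest vs' es'" using q(1,2) longestD(1)[OF p] by (simp add: longest_def)
  then have "closes vs' es' (es ! j)"
    unfolding closes_def q(3,4,6) using \<open>es ! j \<noteq> g\<close> longestD(10-12)[OF p j] by simp
  then show thesis by (rule that[OF _ q(4-6)])
qed

text \<open>The path edges may change, but the edge set \<open>insert g (set es)\<close> of the
  cycle does not.\<close>

lemma closes_rotate_last:
  assumes c: "closes vs es g" and x: "x \<in> set vs"
  obtains vs' es' g' where "closes vs' es' g'" "last vs' = x" "set vs' = set vs"
    "insert g' (set es') = insert g (set es)"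
proof -
  have p: "longest vs es" using c by (simp add: closes_def)
  obtain j where j: "j < k + 1" "x = vs ! j" using x longestD(2)[OF p] by (metis in_set_conv_nth)
  show thesis
  proof (cases "j = k")
    case True
    then show thesis using that[OF c] j longestD(8)[OF p] by simp
  next
    case False
    then have "j < k" using j by simp
    then have "es ! j \<in> set es" using longestD(1)[OF p] by simp
    obtain vs' es' where
      q: "closes vs' es' (es ! j)" "last vs' = vs ! j" "set vs' = set vs"
      "set es' = insert g (set es - {es ! j})" by (rule closes_rotate[OF c \<open>j < k\<close>])
    then have "insert (es ! j) (set es') = insert g (set es)"
      using \<open>es ! j \<in> set es\<close> by blast
    with q show thesis using that j(2) by simp
  qed
qed

lemma closes_spanning:
  assumes c: "closes vs es g" and conn: "connected_hypergraph V E"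
  shows "set vs = V"
proof (rule ccontr)
  assume neq: "set vs \<noteq> V"
  have p: "longest vs es" using c by (simp add: closes_def)
  then obtain w where w: "w \<in> V" "w \<notin> set vs" using neq longestD(5) by blast
  moreover have "hd vs \<in> set vs" using longestD(9)[OF p] by simp
  moreover from this have "hd vs \<in> V" using longestD(5)[OF p] by blast
  moreover have "hd vs \<noteq> w" using w(2) \<open>hd vs \<in> set vs\<close> by metis
  ultimately obtain us fs where "berge_path V E us fs" "hd us = hd vs" "last us = w"
    using conn unfolding connected_hypergraph_def by blast
  then have "\<exists>h\<in>E. h \<inter> set vs \<noteq> {} \<and> \<not> h \<subseteq> set vs"
    using berge_path_leaves[of V E us fs "set vs"] w(2) \<open>hd vs \<in> set vs\<close> by simp
  then obtain h x where h: "h \<in> E" "\<not> h \<subseteq> set vs" "x \<in> h" "x \<in> set vs" by blast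
  have "\<exists>vs' es' g'. closes vs' es' g' \<and> set vs' = set vs \<and> h \<notin> set es' \<and> last vs' \<in> h"
  proof (cases "h \<in> set es")
    case True
    then obtain j where j: "j < k" "h = es ! j" using longestD(1)[OF p] by (metis in_set_conv_nth)
    obtain vs' es' where "closes vs' es' h" "last vs' = vs ! j" "set vs' = set vs"
      "set es' = insert g (set es - {h})"
      unfolding j(2) by (rule closes_rotate[OF c j(1)])
    then show ?thesis unfolding closes_def by blast
  next
    case False
    show ?thesis
    proof (cases "h = g")
      case True
      then show ?thesis using c by (auto simp: closes_def)
    next
      case h_neq: False
      obtain vs' es' g' where q: "closes vs' es' g'" "last vs' = x" "set vs' = set vs"
        and "insert g' (set es') = insert g (set es)"
        by (rule closes_rotate_last[OF c h(4)])
      then have "set es' \<subseteq> insert g (set es)" by blast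
      then have "h \<notin> set es'" using h_neq False by blast
      then show ?thesis using q h(3) by (intro exI[of _ vs'] exI[of _ es'] exI[of _ g']) simp
    qed
  qed
  then obtain vs' es' g' where "longest vs' es'" "set vs' = set vs" "h \<notin> set es'" "last vs' \<in> h"
    by (auto simp: closes_def)
  then show False using no_extension[of vs' es' h] h by blast
qed

lemma closes_good:
  assumes c: "closes vs es g" and conn: "connected_hypergraph V E" and "r \<le> k"
  shows "card V = k + 1" "good_set r V E V"
proof -
  have p: "longest vs es" using c by (simp add: closes_def)
  have V: "set vs = V" using closes_spanning[OF c conn] .
  then show cV: "card V = k + 1" using longestD(2,3)[OF p] by (metis distinct_card)
  show "good_set r V E V"
  proof (rule good_setI)
    show "V \<noteq> {}" using cV by auto
    show "V \<subseteq> ends"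
    proof
      fix x assume "x \<in> V"
      then have "x \<in> set vs" using V by simp
      then obtain vs' es' g' where "closes vs' es' g'" "last vs' = x" "set vs' = set vs"
        "insert g' (set es') = insert g (set es)"
        by (rule closes_rotate_last[OF c])
      then show "x \<in> ends" by (auto simp: closes_def ends_def)
    qed
    have "E \<subseteq> {e. e \<subseteq> V \<and> card e = r}" using edge_subset card_edge by blast
    then have "card E \<le> card {e. e \<subseteq> V \<and> card e = r}"
      using finite_V by (intro card_mono) auto
    then have "card E \<le> (k + 1) choose r" using finite_V cV by (simp add: n_subsets)
    \<comment> \<open>Absorption turns the number of all \<open>r\<close>-subsets into exactly the
      required bound, with no slack.\<close>
    moreover have "r * ((k + 1) choose r) = (k + 1) * (k choose (r - 1))"
      using Suc_times_binomial[of "r - 1" k] r_ge_2 by simp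
    ultimately have "r * card E \<le> (k choose (r - 1)) * card V"
      unfolding cV by (metis mult.commute mult_le_mono2)
    moreover have "card (incident_edges E V) \<le> card E"
      using finite_E by (intro card_mono) (auto simp: incident_edges_def)
    ultimately show "r * card (incident_edges E V) \<le> (k choose (r - 1)) * card V"
      by (meson le_trans mult_le_mono2)
  qed fact
qed

end

text \<open>Edges in \<open>F\<close> are bounded both by their total number and by a degree count,
  since either may be the smaller.\<close>

lemma card_incident_edges_le:
  assumes "finite S" "finite E" "F \<subseteq> E"
    and d: "\<And>x. x \<in> S \<Longrightarrow> card {g \<in> F. x \<in> g} \<le> d"
    and c: "\<And>x. x \<in> S \<Longrightarrow> card {g \<in> E - F. x \<in> g} \<le> c"
  shows "card (incident_edges E S) \<le> min (card F) (card S * d) + card S * c"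
proof -
  have fin: "finite F" using assms finite_subset by blast
  have union: "card (\<Union>x\<in>S. {g \<in> G. x \<in> g}) \<le> card S * b"
    if "\<And>x. x \<in> S \<Longrightarrow> card {g \<in> G. x \<in> g} \<le> b" for G and b
  proof -
    have "card (\<Union>x\<in>S. {g \<in> G. x \<in> g}) \<le> (\<Sum>x\<in>S. card {g \<in> G. x \<in> g})"
      using \<open>finite S\<close> by (rule card_UN_le)
    also have "\<dots> \<le> card S * b" using sum_bounded_above[of S _ b] that by simp
    finally show ?thesis .
  qed
  have "incident_edges E S = (\<Union>x\<in>S. {g \<in> F. x \<in> g}) \<union> (\<Union>x\<in>S. {g \<in> E - F. x \<in> g})"
    using \<open>F \<subseteq> E\<close> by (auto simp: incident_edges_def)
  then have "card (incident_edges E S)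
      \<le> card (\<Union>x\<in>S. {g \<in> F. x \<in> g}) + card (\<Union>x\<in>S. {g \<in> E - F. x \<in> g})"
    by (simp add: card_Un_le)
  moreover have "card (\<Union>x\<in>S. {g \<in> F. x \<in> g}) \<le> card F"
    using fin by (intro card_mono) auto
  moreover note union[of F d, OF d] union[of "E - F" c, OF c]
  ultimately show ?thesis by linarith
qed

section \<open>Longest paths that no edge closes to a cycle\<close>

locale longest_berge_paths_no_cycle = longest_berge_paths +
  assumes no_cycle: "\<not> closes vs es g" and r_le_k: "r \<le> k"
begin

text \<open>Rotating with \<open>e\<close> makes v_{j+1} the last vertex, and then \<open>e'\<close>
  closes the new path. Either edge may be \<open>es ! j\<close> itself, which the rotation
  releases.\<close>

lemma no_crossing_edges:
  assumes p: "longest vs es" and j: "j < k"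
    and e: "e \<in> E" "e \<notin> set es - {es ! j}" "last vs \<in> e" "vs ! j \<in> e"
    and e': "e' \<in> E" "e' \<notin> set es - {es ! j}" "hd vs \<in> e'" "vs ! (j + 1) \<in> e'"
    and "e \<noteq> e'"
  shows False
proof -
  obtain vs' es' where "longest vs' es'" "hd vs' = hd vs" "last vs' = vs ! (j + 1)"
    "set vs' = set vs" "set es' = insert e (set es - {es ! j})"
    by (rule longest_posa_rotation[OF p j e])
  then have "closes vs' es' e'" using e' \<open>e \<noteq> e'\<close> by (simp add: closes_def)
  then show False using no_cycle by blast
qed

abbreviation last_nbrs :: "'a list \<Rightarrow> 'a set list \<Rightarrow> 'a set" where
  "last_nbrs vs es \<equiv> private_nbrs E (set es) (last vs)"

abbreviation hd_nbrs :: "'a list \<Rightarrow> 'a set list \<Rightarrow> 'a set" where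
  "hd_nbrs vs es \<equiv> private_nbrs E (set es) (hd vs)"

lemma last_nbrs_indices:
  assumes p: "longest vs es"
  shows "last_nbrs vs es \<subseteq> (!) vs ` {j. j < k \<and> vs ! j \<in> last_nbrs vs es}"
proof
  fix y assume y: "y \<in> last_nbrs vs es"
  then obtain g where g: "g \<in> E" "g \<notin> set es" "last vs \<in> g" "y \<in> g" "y \<noteq> last vs"
    by (auto simp: mem_private_nbrs)
  then have "y \<in> set vs" using no_extension[OF p] by blast
  then obtain j where j: "j < k + 1" "vs ! j = y" using longestD(2)[OF p] by (metis in_set_conv_nth)
  then have "j \<noteq> k" using g(5) longestD(8)[OF p] by metis
  then have "j < k" using j by simp
  then show "y \<in> (!) vs ` {j. j < k \<and> vs ! j \<in> last_nbrs vs es}" using y j by blast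
qed

text \<open>This is \<open>last_nbrs_indices\<close> for the reversed path. The shift by one turns
  an index common to both families into a crossing pair.\<close>

lemma hd_nbrs_indices:
  assumes p: "longest vs es"
  shows "hd_nbrs vs es \<subseteq> (\<lambda>j. vs ! (j + 1)) ` {j. j < k \<and> vs ! (j + 1) \<in> hd_nbrs vs es}"
proof
  fix y assume y: "y \<in> hd_nbrs vs es"
  then have "y \<in> last_nbrs (rev vs) (rev es)" using longestD(9)[OF p] by (simp add: last_rev)
  with last_nbrs_indices[OF longest_rev[OF p]]
  obtain j where j: "j < k" "y = rev vs ! j" by blast
  then have "y = vs ! (k - j)" using longestD(2)[OF p] by (simp add: rev_nth)
  moreover have "k - j = k - j - 1 + 1" using j by simp
  ultimately have "k - j - 1 < k" "y = vs ! (k - j - 1 + 1)" using j by auto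
  then show "y \<in> (\<lambda>j. vs ! (j + 1)) ` {j. j < k \<and> vs ! (j + 1) \<in> hd_nbrs vs es}"
    using y by blast
qed

text \<open>The edges witnessing the two memberships differ, since a common one would close the
  path; hence they cross.\<close>

lemma nbrs_indices_disjoint:
  assumes p: "longest vs es" and j: "j < k" and "vs ! j \<in> last_nbrs vs es" "vs ! (j + 1) \<in> hd_nbrs vs es"
  shows False
proof -
  obtain e e' where "e \<in> E" "e \<notin> set es" "last vs \<in> e" "vs ! j \<in> e"
    "e' \<in> E" "e' \<notin> set es" "hd vs \<in> e'" "vs ! (j + 1) \<in> e'"
    using assms by (auto simp: mem_private_nbrs)
  moreover from this have "e \<noteq> e'" using no_cycle[of vs es e] p by (auto simp: closes_def)
  ultimately show False using no_crossing_edges[OF p j, of e e'] by blast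
qed

lemma nbrs_indices_card:
  assumes p: "longest vs es"
  shows "card {j. j < k \<and> vs ! j \<in> last_nbrs vs es} + card {j. j < k \<and> vs ! (j + 1) \<in> hd_nbrs vs es} \<le> k"
proof -
  let ?I = "{j. j < k \<and> vs ! j \<in> last_nbrs vs es}" and ?J = "{j. j < k \<and> vs ! (j + 1) \<in> hd_nbrs vs es}"
  have "card ?I + card ?J = card (?I \<union> ?J)"
    using nbrs_indices_disjoint[OF p] by (intro card_Un_disjoint[symmetric]) auto
  also have "\<dots> \<le> card {..<k}" by (intro card_mono) auto
  finally show ?thesis by simp
qed

lemma card_last_nbrs_le:
  assumes "longest vs es"
  shows "card (last_nbrs vs es) \<le> card {j. j < k \<and> vs ! j \<in> last_nbrs vs es}"
  using last_nbrs_indices[OF assms] by (rule surj_card_le[rotated]) simp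

lemma card_hd_nbrs_le:
  assumes "longest vs es"
  shows "card (hd_nbrs vs es) \<le> card {j. j < k \<and> vs ! (j + 1) \<in> hd_nbrs vs es}"
  using hd_nbrs_indices[OF assms] by (rule surj_card_le[rotated]) simp

lemma finite_private_nbrs: "finite (private_nbrs E F x)"
  using finite_E finite_edge by (auto simp: private_nbrs_def)

text \<open>Deleting \<open>x\<close> maps these edges injectively to \<open>(r - 1)\<close>-sets of
  private neighbours.\<close>

lemma card_private_edges:
  "card {g \<in> E - F. x \<in> g} \<le> card (private_nbrs E F x) choose (r - 1)"
proof -
  have "inj_on (\<lambda>g. g - {x}) {g \<in> E - F. x \<in> g}" by (auto simp: inj_on_def)
  moreover have "(\<lambda>g. g - {x}) ` {g \<in> E - F. x \<in> g} \<subseteq> {T. T \<subseteq> private_nbrs E F x \<and> card T = r - 1}"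
    using card_edge finite_edge by (auto simp: mem_private_nbrs)
  ultimately have "card {g \<in> E - F. x \<in> g} \<le> card {T. T \<subseteq> private_nbrs E F x \<and> card T = r - 1}"
    using finite_private_nbrs by (intro card_inj_on_le) auto
  then show ?thesis using finite_private_nbrs by (simp add: n_subsets)
qed

text \<open>The ends of the paths with the same first vertex and the same edges that one rotation yields.\<close>

definition rotation_ends :: "'a list \<Rightarrow> 'a set list \<Rightarrow> 'a set" where
  "rotation_ends vs es = (\<lambda>j. vs ! (j + 1)) ` {j. j < k \<and> last vs \<in> es ! j}"

lemma card_path_edges:
  assumes p: "longest vs es"
  shows "card {g \<in> set es. x \<in> g} = card {j. j < k \<and> x \<in> es ! j}"
proof -
  have "inj_on ((!) es) {j. j < k \<and> x \<in> es ! j}"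
    using longestD(1,4)[OF p] by (auto simp: inj_on_def nth_eq_iff_index_eq)
  then have "card ((!) es ` {j. j < k \<and> x \<in> es ! j}) = card {j. j < k \<and> x \<in> es ! j}"
    by (rule card_image)
  moreover have "(!) es ` {j. j < k \<and> x \<in> es ! j} = {g \<in> set es. x \<in> g}"
    using longestD(1)[OF p] by (auto simp: in_set_conv_nth)
  ultimately show ?thesis by simp
qed

text \<open>So the number of ends equals the path degree \<open>d\<close> of the last vertex, which
  is the source of the term \<open>d * d\<close> below.\<close>

lemma card_rotation_ends:
  assumes p: "longest vs es"
  shows "card (rotation_ends vs es) = card {g \<in> set es. last vs \<in> g}"
proof -
  let ?D = "{j. j < k \<and> last vs \<in> es ! j}"
  have "inj_on (\<lambda>j. vs ! (j + 1)) ?D"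
    using longestD(2,3)[OF p] by (auto simp: inj_on_def nth_eq_iff_index_eq)
  then have "card (rotation_ends vs es) = card ?D"
    unfolding rotation_ends_def by (rule card_image)
  then show ?thesis by (simp add: card_path_edges[OF p])
qed

lemma rotation_endsE:
  assumes p: "longest vs es" and x: "x \<in> rotation_ends vs es"
  obtains vs' es' where "longest vs' es'" "hd vs' = hd vs" "last vs' = x" "set es' = set es"
proof -
  obtain j where j: "j < k" "last vs \<in> es ! j" "x = vs ! (j + 1)"
    using x by (auto simp: rotation_ends_def)
  have "es ! j \<in> set es" using j longestD(1)[OF p] by simp
  \<comment> \<open>With \<open>es ! j\<close> as connecting edge the rotation puts the removed edge
    back.\<close>
  obtain vs' es' where q: "longest vs' es'" "hd vs' = hd vs" "last vs' = vs ! (j + 1)"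
    "set vs' = set vs" "set es' = insert (es ! j) (set es - {es ! j})"
    by (rule longest_posa_rotation[OF p j(1), of "es ! j"])
      (use j longestD(10,12)[OF p j(1)] in auto)
  have "set es' = set es" unfolding q(5) using \<open>es ! j \<in> set es\<close> by blast
  with q j(3) show thesis using that by simp
qed

lemma rotation_ends_subset_ends: "longest vs es \<Longrightarrow> rotation_ends vs es \<subseteq> ends"
  unfolding ends_def by (blast elim: rotation_endsE)

lemma rotation_ends_nonempty: "longest vs es \<Longrightarrow> rotation_ends vs es \<noteq> {}"
proof -
  assume p: "longest vs es"
  have "last vs \<in> es ! (k - 1)" using longestD(8)[OF p] longestD(11)[OF p, of "k - 1"] k_pos by simp
  then show ?thesis using k_pos by (auto simp: rotation_ends_def intro!: exI[of _ "k - 1"])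
qed

text \<open>The positions \<open>j + 1\<close> are never 0, so the first vertex is missed. This
  secures the alternative \<open>card S < n\<close>.\<close>

lemma card_rotation_ends_less:
  assumes p: "longest vs es"
  shows "card (rotation_ends vs es) < card V"
proof (rule psubset_card_mono[OF finite_V])
  have "vs ! (j + 1) \<in> set vs - {hd vs}" if "j < k" for j
    using that longestD(2,3,7)[OF p] nth_eq_iff_index_eq[of vs "j + 1" 0] by simp
  then have "rotation_ends vs es \<subseteq> set vs - {hd vs}" by (auto simp: rotation_ends_def)
  moreover have "hd vs \<in> V" using longestD(5,9)[OF p] hd_in_set by blast
  ultimately show "rotation_ends vs es \<subset> V" using longestD(5)[OF p] by blast
qed

text \<open>Two nested extremal choices: \<open>hd_nbrs\<close> is made largest over all longest
  paths; then the first vertex and the edge set are frozen and the path degree of the last vertex is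
  maximised.\<close>

lemma exists_balanced_end:
  assumes "longest us fs"
  shows "\<exists>vs es. longest vs es \<and>
    (\<forall>us fs. longest us fs \<longrightarrow> hd us = hd vs \<longrightarrow> set fs = set es \<longrightarrow>
       card (last_nbrs us fs) \<le> k div 2 \<and>
       card {g \<in> set es. last us \<in> g} \<le> card {g \<in> set es. last vs \<in> g})"
proof -
  have hd_bound: "card (hd_nbrs us fs) \<le> k" if "longest us fs" for us fs
    using card_hd_nbrs_le[OF that] nbrs_indices_card[OF that] by linarith
  have "\<exists>q. (case q of (vs, es) \<Rightarrow> longest vs es) \<and>
    (\<forall>q'. (case q' of (vs, es) \<Rightarrow> longest vs es) \<longrightarrow>
      (case q' of (vs, es) \<Rightarrow> card (hd_nbrs vs es)) \<le> (case q of (vs, es) \<Rightarrow> card (hd_nbrs vs es)))"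
  proof (rule ex_has_greatest_nat)
    show "case (us, fs) of (vs, es) \<Rightarrow> longest vs es" using assms by simp
    show "\<forall>q'. (case q' of (vs, es) \<Rightarrow> longest vs es) \<longrightarrow>
      (case q' of (vs, es) \<Rightarrow> card (hd_nbrs vs es)) < k + 1"
      by (auto simp: less_Suc_eq_le hd_bound)
  qed
  then obtain vs0 es0 where p0: "longest vs0 es0"
    and max: "\<And>us fs. longest us fs \<Longrightarrow> card (hd_nbrs us fs) \<le> card (hd_nbrs vs0 es0)"
    by auto
  \<comment> \<open>\<open>hd_nbrs\<close> depends only on the first vertex and the edge set, so
    every path counted by \<open>Q\<close> still attains the first maximum.\<close>
  define Q where "Q v \<longleftrightarrow> (\<exists>vs es. longest vs es \<and> hd vs = hd vs0 \<and> set es = set es0 \<and> last vs = v)" for v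
  have "\<exists>v. Q v \<and> (\<forall>u. Q u \<longrightarrow> card {g \<in> set es0. u \<in> g} \<le> card {g \<in> set es0. v \<in> g})"
  proof (rule ex_has_greatest_nat)
    show "Q (last vs0)" using p0 unfolding Q_def by blast
    show "\<forall>u. Q u \<longrightarrow> card {g \<in> set es0. u \<in> g} < card (set es0) + 1"
      by (simp add: card_mono less_Suc_eq_le)
  qed
  then obtain v where v: "Q v"
    and max1: "\<And>u. Q u \<Longrightarrow> card {g \<in> set es0. u \<in> g} \<le> card {g \<in> set es0. v \<in> g}"
    by blast
  obtain vs1 es1 where p1: "longest vs1 es1" "hd vs1 = hd vs0" "set es1 = set es0" "last vs1 = v"
    using v unfolding Q_def by (elim exE conjE) (rule that)
  have "card (last_nbrs us fs) \<le> k div 2 \<and>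
      card {g \<in> set es1. last us \<in> g} \<le> card {g \<in> set es1. last vs1 \<in> g}"
    if q: "longest us fs" "hd us = hd vs1" "set fs = set es1" for us fs
  proof
    \<comment> \<open>Reversal makes the last vertex a first one, so maximality bounds
      \<open>last_nbrs\<close> by \<open>hd_nbrs\<close>, while the two sizes add up to at most
      \<open>k\<close>.\<close>
    have "last_nbrs us fs = hd_nbrs (rev us) (rev fs)"
      using longestD(9)[OF q(1)] by (simp add: hd_rev)
    then have "card (last_nbrs us fs) \<le> card (hd_nbrs us fs)"
      using max[OF longest_rev[OF q(1)]] q p1 by simp
    moreover have "card (last_nbrs us fs) + card (hd_nbrs us fs) \<le> k"
      using card_last_nbrs_le[OF q(1)] card_hd_nbrs_le[OF q(1)] nbrs_indices_card[OF q(1)] by linarith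
    ultimately show "card (last_nbrs us fs) \<le> k div 2" by simp
    have "hd us = hd vs0" "set fs = set es0" using q p1 by simp_all
    then have "Q (last us)" unfolding Q_def using q(1) by (intro exI[of _ us] exI[of _ fs]) simp
    then show "card {g \<in> set es1. last us \<in> g} \<le> card {g \<in> set es1. last vs1 \<in> g}"
      unfolding p1(3,4) by (rule max1)
  qed
  then show ?thesis using p1(1) by blast
qed

text \<open>The inequality is used at the path degree that the extremal choice produces; this is not
  known beforehand, hence the quantifier over \<open>d\<close>.\<close>

lemma good_set_from_inequality:
  assumes "longest vs es"
    and ineq: "\<And>d. r * (min k (d * d) + d * (k div 2 choose (r - 1))) \<le> (k choose (r - 1)) * d"
  shows "\<exists>S. good_set r V E S \<and> card S < card V"
proof -
  obtain vs es where p: "longest vs es"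
    and max: "\<forall>us fs. longest us fs \<longrightarrow> hd us = hd vs \<longrightarrow> set fs = set es \<longrightarrow>
       card (last_nbrs us fs) \<le> k div 2 \<and>
       card {g \<in> set es. last us \<in> g} \<le> card {g \<in> set es. last vs \<in> g}"
    using exists_balanced_end[OF assms(1)] by (elim exE conjE) (rule that)
  let ?S = "rotation_ends vs es" and ?d = "card {g \<in> set es. last vs \<in> g}"
  have d: "card {g \<in> set es. x \<in> g} \<le> ?d"
    and c: "card {g \<in> E - set es. x \<in> g} \<le> k div 2 choose (r - 1)" if "x \<in> ?S" for x
  proof -
    obtain us fs where q: "longest us fs" "hd us = hd vs" "last us = x" "set fs = set es"
      by (rule rotation_endsE[OF p \<open>x \<in> ?S\<close>])
    note m = max[rule_format, OF q(1,2,4)]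
    show "card {g \<in> set es. x \<in> g} \<le> ?d" using m q(3) by simp
    have "card (private_nbrs E (set es) x) \<le> k div 2" using m q(3,4) by simp
    then show "card {g \<in> E - set es. x \<in> g} \<le> k div 2 choose (r - 1)"
      using card_private_edges[of "set es" x] binomial_right_mono le_trans by blast
  qed
  have "finite ?S" by (simp add: rotation_ends_def)
  then have "card (incident_edges E ?S)
      \<le> min (card (set es)) (card ?S * ?d) + card ?S * (k div 2 choose (r - 1))"
    using card_incident_edges_le[OF _ finite_E longestD(6)[OF p] d c] by blast
  also have "\<dots> = min k (?d * ?d) + ?d * (k div 2 choose (r - 1))"
    using longestD(1,4)[OF p] by (simp add: card_rotation_ends[OF p] distinct_card)
  finally have "r * card (incident_edges E ?S) \<le> (k choose (r - 1)) * card ?S"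
    unfolding card_rotation_ends[OF p] using ineq[of ?d] by (meson le_trans mult_le_mono2)
  then have "good_set r V E ?S"
    using rotation_ends_nonempty[OF p] rotation_ends_subset_ends[OF p] r_le_k by (intro good_setI)
  then show ?thesis using card_rotation_ends_less[OF p] by blast
qed

end

subsection \<open>The binomial inequality\<close>

text \<open>Factor by factor, \<open>2 * (m - i) \<le> 2 * m - i\<close>, also under truncated
  subtraction.\<close>

lemma two_power_binomial_le: "2 ^ j * (m choose j) \<le> (2 * m) choose j"
proof (induction j)
  case (Suc j)
  have rec: "Suc j * (n choose Suc j) = (n - j) * (n choose j)" for n
    using binomial_absorption[of j n] binomial_absorb_comp[of n j] by simp
  have "Suc j * (2 ^ Suc j * (m choose Suc j)) = 2 ^ Suc j * (Suc j * (m choose Suc j))"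
    by (simp only: ac_simps)
  also have "\<dots> = (2 * (m - j)) * (2 ^ j * (m choose j))" unfolding rec by simp
  also have "\<dots> \<le> (2 * m - j) * ((2 * m) choose j)"
    using Suc.IH by (intro mult_le_mono) auto
  also have "\<dots> = Suc j * ((2 * m) choose Suc j)" by (rule rec[symmetric])
  finally show ?case using mult_le_cancel1 by blast
qed simp

text \<open>With square roots: the minimum is at most d sqrt(k), and 4 sqrt(k) is at most k + 4. The
  bound is linear in \<open>d\<close>, so \<open>d\<close> cancels afterwards.\<close>

lemma four_min_square_le: "4 * min k (d * d) \<le> d * (k + 4)" for k d :: nat
proof -
  have "real (4 * min k (d * d)) \<le> real (d * (k + 4))"
  proof -
    define m where "m = real (min k (d * d))"
    have m: "m \<le> real k" "m \<le> real d * real d" "0 \<le> m"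
      by (auto simp: m_def simp flip: of_nat_mult)
    have "4 * m \<le> real d * (m + 4)"
    proof (cases "d \<ge> 4")
      case True
      then have "4 * m \<le> real d * m" using m by (intro mult_right_mono) auto
      then show ?thesis by (simp add: algebra_simps)
    next
      case False
      \<comment> \<open>For \<open>d < 4\<close> the bound \<open>m \<le> d * d\<close> is used,
        together with \<open>d * (4 - d) = 4 - (d - 2)^2\<close>.\<close>
      then have "m * (4 - real d) \<le> real d * real d * (4 - real d)"
        using m by (intro mult_right_mono) auto
      also have "\<dots> = real d * (4 - (real d - 2)\<^sup>2)" by (simp add: power2_eq_square algebra_simps)
      also have "\<dots> \<le> real d * 4" by (intro mult_left_mono) auto
      finally show ?thesis by (simp add: algebra_simps)
    qed
    also have "\<dots> \<le> real d * (real k + 4)" using m by (intro mult_left_mono) auto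
    finally show ?thesis by (simp add: m_def)
  qed
  then show ?thesis by (simp only: of_nat_le_iff)
qed

lemma double_choose_two: "2 * (n choose 2) = n * (n - 1)"
  using binomial_absorption[of 1 n] by (simp add: numeral_2_eq_2)

text \<open>Binomials increase up to the middle; symmetry carries the bound to the upper
  half.\<close>

lemma choose_two_le:
  assumes "2 \<le> j" "j + 2 \<le> n"
  shows "n choose 2 \<le> n choose j"
proof (cases "2 * j \<le> n")
  case True
  then show ?thesis using assms by (intro binomial_mono) auto
next
  case False
  then have "n choose 2 \<le> n choose (n - j)" using assms by (intro binomial_mono) auto
  then show ?thesis using assms by (simp add: binomial_symmetric[of j n])
qed

lemma six_choose_three: "6 * (n choose 3) = n * (n - 1) * (n - 2)"
proof -
  have "3 * (n choose 3) = n * ((n - 1) choose 2)"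
    using binomial_absorption[of 2 n] by (simp add: numeral_3_eq_3 numeral_2_eq_2)
  then have "6 * (n choose 3) = n * (2 * ((n - 1) choose 2))" by simp
  also have "\<dots> = n * ((n - 1) * (n - 1 - 1))" by (simp only: double_choose_two)
  also have "n - 1 - 1 = n - 2" by simp
  finally show ?thesis by (simp only: mult.assoc)
qed

text \<open>If the binomial of \<open>k div 2\<close> vanishes, a quadratic bound is enough;
  otherwise each term on the left takes at most half of the right-hand side.\<close>

lemma binomial_inequality_ge4:
  fixes r k :: nat
  assumes "4 \<le> r" "r < k"
  shows "r * (k + 4) + 4 * r * (k div 2 choose (r - 1)) \<le> 4 * (k choose (r - 1))"
proof (cases "k div 2 < r - 1")
  case True
  have "r * (k + 4) \<le> (k - 1) * (2 * k)" using assms by (intro mult_le_mono) auto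
  also have "\<dots> = 4 * (k choose 2)" using double_choose_two[of k] by simp
  also have "\<dots> \<le> 4 * (k choose (r - 1))" using assms choose_two_le[of "r - 1" k] by simp
  finally show ?thesis using True by (simp add: binomial_eq_0)
next
  case False
  then have rk: "2 * r \<le> k + 2" by simp
  then have k6: "6 \<le> k" using assms by simp
  \<comment> \<open>\<open>2 * r \<le> 2 ^ (r - 1)\<close> holds with equality at
    \<open>r = 4\<close> and fails at \<open>r = 3\<close>, which therefore needs its own
    lemma.\<close>
  have "2 * (4 + i) \<le> 2 ^ (4 + i - 1)" for i :: nat by (induction i) (auto simp: numeral_eq_Suc)
  from this[of "r - 4"] have "2 * r \<le> 2 ^ (r - 1)" using assms by simp
  then have "2 * r * (k div 2 choose (r - 1)) \<le> 2 ^ (r - 1) * (k div 2 choose (r - 1))" by simp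
  also have "\<dots> \<le> (2 * (k div 2)) choose (r - 1)" by (rule two_power_binomial_le)
  also have "\<dots> \<le> k choose (r - 1)" by (intro binomial_right_mono) simp
  finally have 1: "4 * r * (k div 2 choose (r - 1)) \<le> 2 * (k choose (r - 1))" by simp
  have "6 * (r * (k + 4)) \<le> 12 * (k choose 3)"
  proof -
    obtain l where k: "k = l + 6" using k6 by (metis le_add_diff_inverse2)
    have "6 * (r * (k + 4)) = 3 * (k + 4) * (2 * r)" by simp
    also have "\<dots> \<le> 3 * (k + 4) * (k + 2)" using rk by (intro mult_le_mono2)
    also have "\<dots> \<le> 2 * (k * (k - 1) * (k - 2))" unfolding k by (simp add: algebra_simps)
    also have "\<dots> = 12 * (k choose 3)" unfolding six_choose_three[symmetric] by simp
    finally show ?thesis .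
  qed
  moreover have "k choose 3 \<le> k choose (r - 1)" using assms rk by (intro binomial_mono) auto
  ultimately show ?thesis using 1 by linarith
qed

text \<open>The estimate is false for \<open>k = 4\<close> and \<open>k = 6\<close>, hence the
  exclusions. Splitting by parity makes both sides polynomials in \<open>m\<close>.\<close>

lemma binomial_inequality_3:
  fixes k :: nat
  assumes "5 \<le> k" "k \<noteq> 6"
  shows "3 * (k + 4) + 12 * (k div 2 choose 2) \<le> 4 * (k choose 2)"
proof -
  define m where "m = k div 2"
  have "3 * (k + 4) + 6 * (m * (m - 1)) \<le> 2 * (k * (k - 1))"
  proof (cases "even k")
    case True
    then have k: "k = 2 * m" by (simp add: m_def)
    then have "m \<ge> 4" using assms by presburger
    then obtain l where "m = l + 4" by (metis le_add_diff_inverse2)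
    then show ?thesis unfolding k by (simp add: algebra_simps)
  next
    case False
    then have k: "k = 2 * m + 1" by (simp add: m_def)
    then have "m \<ge> 2" using assms by simp
    then obtain l where "m = l + 2" by (metis le_add_diff_inverse2)
    then show ?thesis unfolding k by (simp add: algebra_simps)
  qed
  then show ?thesis using double_choose_two[of k] double_choose_two[of m] by (simp add: m_def)
qed

text \<open>For \<open>r = 3\<close> and \<open>k = 4\<close> the inequality fails at
  \<open>d = 2\<close>, where it would read \<open>18 \<le> 12\<close>.\<close>

lemma binomial_inequality:
  fixes r k d :: nat
  assumes "3 \<le> r" "r < k" "\<not> (r = 3 \<and> k = 4)"
  shows "r * (min k (d * d) + d * (k div 2 choose (r - 1))) \<le> (k choose (r - 1)) * d"
proof (cases "r = 3 \<and> k = 6")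
  case True
  \<comment> \<open>The claim reduces to this bound, which relies on \<open>d\<close> being an
    integer; \<open>four_min_square_le\<close> gives only 5d/2.\<close>
  have "min 6 (d * d) \<le> 2 * d"
  proof (cases "d \<ge> 3")
    case False
    then have "d = 0 \<or> d = 1 \<or> d = 2" by auto
    then show ?thesis by auto
  qed simp
  then show ?thesis using True by (simp add: choose_two)
next
  case False
  have "r * (k + 4) + 4 * r * (k div 2 choose (r - 1)) \<le> 4 * (k choose (r - 1))"
  proof (cases "r = 3")
    case True
    then show ?thesis using binomial_inequality_3[of k] assms False by simp
  next
    case False
    then show ?thesis using binomial_inequality_ge4[of r k] assms by simp
  qed
  then have "d * (r * (k + 4) + 4 * r * (k div 2 choose (r - 1))) \<le> d * (4 * (k choose (r - 1)))"
    by (rule mult_le_mono2)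
  moreover have "r * (4 * min k (d * d)) \<le> r * (d * (k + 4))"
    using four_min_square_le by (rule mult_le_mono2)
  ultimately show ?thesis by (simp add: algebra_simps)
qed

subsection \<open>The case of 3-uniform hypergraphs with longest path length 4\<close>

context longest_berge_paths_no_cycle
begin

text \<open>This is \<open>no_crossing_edges\<close> with \<open>es ! j\<close> itself as the edge
  at the first vertex.\<close>

lemma hd_notin_path_edge:
  assumes p: "longest vs es" and j: "j < k" "vs ! j \<in> last_nbrs vs es"
  shows "hd vs \<notin> es ! j"
proof
  assume h: "hd vs \<in> es ! j"
  obtain e where e: "e \<in> E" "e \<notin> set es" "last vs \<in> e" "vs ! j \<in> e"
    using j(2) by (auto simp: mem_private_nbrs)
  have "es ! j \<in> set es" using longestD(1)[OF p] j by simp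
  then have "e \<noteq> es ! j" using e by blast
  then show False
    using no_crossing_edges[OF p j(1), of e "es ! j"] e h longestD(11,12)[OF p j(1)] by blast
qed

lemma last_notin_path_edge:
  assumes p: "longest vs es" and j: "j < k" "vs ! (j + 1) \<in> hd_nbrs vs es"
  shows "last vs \<notin> es ! j"
proof
  assume h: "last vs \<in> es ! j"
  obtain e where e: "e \<in> E" "e \<notin> set es" "hd vs \<in> e" "vs ! (j + 1) \<in> e"
    using j(2) by (auto simp: mem_private_nbrs)
  have "es ! j \<in> set es" using longestD(1)[OF p] j by simp
  then have "es ! j \<noteq> e" using e by blast
  then show False
    using no_crossing_edges[OF p j(1), of "es ! j" e] e h longestD(10,12)[OF p j(1)] by blast
qed

lemma private_edge_subset:
  assumes "g \<in> E - F" "x \<in> g"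
  shows "g - {x} \<subseteq> private_nbrs E F x" "card (g - {x}) = r - 1"
  using assms card_edge finite_edge by (auto simp: mem_private_nbrs)

lemma card_private_nbrs_ge:
  assumes "card {g \<in> E - F. x \<in> g} > 0"
  shows "r - 1 \<le> card (private_nbrs E F x)"
proof -
  obtain g where "g \<in> E - F" "x \<in> g" using assms by (metis (mono_tags, lifting) card_gt_0_iff empty_Collect_eq)
  then show ?thesis
    using private_edge_subset[of g F x] card_mono[OF finite_private_nbrs] by metis
qed

lemma card_edges_split:
  assumes "F \<subseteq> E"
  shows "card {g \<in> E. x \<in> g} = card {g \<in> F. x \<in> g} + card {g \<in> E - F. x \<in> g}"
proof -
  have "{g \<in> E. x \<in> g} = {g \<in> F. x \<in> g} \<union> {g \<in> E - F. x \<in> g}" using assms by blast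
  moreover have "finite {g \<in> F. x \<in> g}" "finite {g \<in> E - F. x \<in> g}"
    using finite_subset[OF assms finite_E] finite_E by auto
  moreover have "{g \<in> F. x \<in> g} \<inter> {g \<in> E - F. x \<in> g} = {}" by blast
  ultimately show ?thesis by (simp only: card_Un_disjoint)
qed

text \<open>Degree 3 at both ends forces every index \<open>j\<close> to be exactly one of: \<open>vs ! j\<close> is a private
  neighbour of the last vertex, or \<open>vs ! (j + 1)\<close> is one of the first vertex.\<close>

lemma last_nbrs_empty_3_4:
  assumes r3: "r = 3" and k4: "k = 4" and p: "longest vs es"
    and deg: "3 \<le> card {g \<in> E. last vs \<in> g}" "3 \<le> card {g \<in> E. hd vs \<in> g}"
  shows "last_nbrs vs es = {}"
proof (rule ccontr)
  assume ne: "last_nbrs vs es \<noteq> {}"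
  define I where "I = {j. j < k \<and> vs ! j \<in> last_nbrs vs es}"
  define J where "J = {j. j < k \<and> vs ! (j + 1) \<in> hd_nbrs vs es}"
  have fin: "finite I" "finite J" by (auto simp: I_def J_def)
  have sub: "I \<subseteq> {..<4}" "J \<subseteq> {..<4}" by (auto simp: I_def J_def k4)
  have IJ: "I \<inter> J = {}" using nbrs_indices_disjoint[OF p] by (auto simp: I_def J_def)
  have cIJ: "card I + card J \<le> 4" using nbrs_indices_card[OF p] by (simp add: I_def J_def k4)
  have cI: "card (last_nbrs vs es) \<le> card I" and cJ: "card (hd_nbrs vs es) \<le> card J"
    using card_last_nbrs_le[OF p] card_hd_nbrs_le[OF p] by (auto simp: I_def J_def)
  let ?a = "{j. j < k \<and> last vs \<in> es ! j}" and ?b = "{j. j < k \<and> hd vs \<in> es ! j}"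
  let ?A = "{g \<in> E - set es. last vs \<in> g}" and ?B = "{g \<in> E - set es. hd vs \<in> g}"
  have a: "?a \<subseteq> {..<4} - J" using last_notin_path_edge[OF p] by (auto simp: J_def k4)
  have b: "?b \<subseteq> {..<4} - I" using hd_notin_path_edge[OF p] by (auto simp: I_def k4)
  have ca: "card ?a \<le> 4 - card J"
    using card_mono[OF _ a] fin sub by (simp add: card_Diff_subset)
  have cb: "card ?b \<le> 4 - card I"
    using card_mono[OF _ b] fin sub by (simp add: card_Diff_subset)
  have degA: "3 \<le> card ?a + card ?A" and degB: "3 \<le> card ?b + card ?B"
    using deg card_edges_split[OF longestD(6)[OF p]] card_path_edges[OF p] by metis+
  obtain g where g: "g \<in> ?A" using ne by (auto simp: private_nbrs_def)
  then have "card ?A > 0" using finite_E by (auto simp: card_gt_0_iff)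
  \<comment> \<open>A private edge brings two neighbours. That leaves at most two path edges at the
    first vertex, so it has a private edge too, and all four sizes are 2.\<close>
  then have I2: "2 \<le> card (last_nbrs vs es)" using card_private_nbrs_ge r3 by fastforce
  have "card ?B > 0" using degB cb I2 cI by linarith
  then have J2: "2 \<le> card (hd_nbrs vs es)" using card_private_nbrs_ge r3 by fastforce
  then obtain h where h: "h \<in> ?B" using \<open>card ?B > 0\<close> by (metis card_gt_0_iff ex_in_conv)
  have two: "card I = 2" "card J = 2" "card (last_nbrs vs es) = 2" "card (hd_nbrs vs es) = 2"
    using I2 J2 cI cJ cIJ by linarith+
  have "card ?A \<le> 1" "card ?B \<le> 1"
    using card_private_edges[of "set es" "last vs"] card_private_edges[of "set es" "hd vs"] two r3
    by simp_all
  \<comment> \<open>Two neighbours support only one private edge, so degree 3 needs two path edges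
    at each end, and the inclusions \<open>a\<close> and \<open>b\<close> become equalities.\<close>
  then have "card ({..<4} - J) \<le> card ?a" "card ({..<4} - I) \<le> card ?b"
    using degA degB two fin sub by (simp_all add: card_Diff_subset)
  then have ab: "?a = {..<4} - J" "?b = {..<4} - I"
    using card_seteq[OF _ a] card_seteq[OF _ b] by auto
  have "card (I \<union> J) = 4" using card_Un_disjoint[OF fin IJ] two by simp
  then have "I \<union> J = {..<4}" using card_subset_eq[of "{..<4}" "I \<union> J"] sub by simp
  then have compl: "{..<4} - J = I" "{..<4} - I = J" using IJ by auto
  have mem: "j \<in> I \<longleftrightarrow> j < 4 \<and> vs ! 4 \<in> es ! j" "j \<in> J \<longleftrightarrow> j < 4 \<and> vs ! 0 \<in> es ! j" for j
    using ab compl longestD(7,8)[OF p] k4 by auto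
  have in_e: "vs ! j \<in> es ! j" "vs ! (j + 1) \<in> es ! j" "es ! j \<in> E" if "j < 4" for j
    using longestD(10-12)[OF p] that k4 by auto
  have "3 \<in> I" using mem(1)[of 3] in_e[of 3] by simp
  moreover have "0 \<in> J" using mem(2)[of 0] in_e[of 0] by simp
  moreover then have "0 \<notin> I" using IJ by blast
  ultimately have cases: "I = {1, 3} \<or> I = {2, 3}"
  proof -
    have "card (I - {3}) = 1" using two(1) \<open>3 \<in> I\<close> by simp
    then obtain i where i: "I - {3} = {i}" by (rule card_1_singletonE)
    then have I: "I = {i, 3}" using \<open>3 \<in> I\<close> by blast
    have "i \<in> I" "i \<noteq> 3" using i by auto
    have "i < 4" using sub(1) \<open>i \<in> I\<close> by auto
    moreover have "i \<noteq> 0" using \<open>0 \<notin> I\<close> \<open>i \<in> I\<close> by metis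
    ultimately have "i = 1 \<or> i = 2" using \<open>i \<noteq> 3\<close> by linarith
    then show ?thesis using I by auto
  qed
  have len: "length vs = 5" "length es = 4" using longestD(1,2)[OF p] k4 by auto
  have dist: "distinct vs" "distinct es" using longestD[OF p] by auto
  have g': "g \<in> E - set es" "last vs \<in> g" and h': "h \<in> E - set es" "hd vs \<in> h"
    using g h by auto
  have "g - {last vs} = last_nbrs vs es"
    using private_edge_subset[OF g'] two(3) r3 by (intro card_subset_eq finite_private_nbrs) simp_all
  moreover have "h - {hd vs} = hd_nbrs vs es"
    using private_edge_subset[OF h'] two(4) r3 by (intro card_subset_eq finite_private_nbrs) simp_all
  moreover have "last_nbrs vs es = (!) vs ` I"
    using last_nbrs_indices[OF p] by (auto simp: I_def)
  moreover have "hd_nbrs vs es = (\<lambda>j. vs ! (j + 1)) ` J"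
    using hd_nbrs_indices[OF p] by (auto simp: J_def)
  ultimately have gh: "g = insert (vs ! 4) ((!) vs ` I)" "h = insert (vs ! 0) ((\<lambda>j. vs ! (j + 1)) ` J)"
    using g h longestD(7,8)[OF p] k4 by auto
  from cases show False
  proof
    \<comment> \<open>Here v_2, v_3, v_4 make up both \<open>g\<close> and \<open>es ! 2\<close>,
      although \<open>g\<close> is off the path.\<close>
    assume I: "I = {2, 3}"
    have "g \<subseteq> es ! 2" using gh(1) mem(1)[of 2] in_e[of 2] I by auto
    moreover have "card g = 3" "card (es ! 2) = 3" "finite (es ! 2)"
      using g card_edge finite_edge in_e(3)[of 2] r3 by auto
    ultimately have "g = es ! 2" using card_subset_eq by metis
    then show False using g len by auto
  next
    assume I: "I = {1, 3}"
    then have J: "J = {0, 2}" using compl(2) by auto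
    obtain v0 v1 v2 v3 v4 where vs: "vs = [v0, v1, v2, v3, v4]"
      using len(1) by (auto simp: numeral_eq_Suc length_Suc_conv)
    obtain e0 e1 e2 e3 where es: "es = [e0, e1, e2, e3]"
      using len(2) by (auto simp: numeral_eq_Suc length_Suc_conv)
    have gh': "g = {v4, v1, v3}" "h = {v0, v1, v3}" using gh I J vs by auto
    have last_mem: "v4 \<in> e1" "v0 \<in> e0" "v0 \<in> e2" using mem(1)[of 1] mem(2)[of 0] mem(2)[of 2] I J vs es by auto
    have path_mem: "v1 \<in> e0" "v2 \<in> e1" "v2 \<in> e2" "v3 \<in> e2"
      using in_e(2)[of 0] in_e(2)[of 1] in_e(1)[of 2] in_e(2)[of 2] vs es by auto
    have g_mem: "v1 \<in> g" "v4 \<in> g" using gh'(1) by auto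
    \<comment> \<open>The 5-cycle is v0 e0 v1 g v4 e1 v2 e2 v3 h, closed by \<open>h\<close> at
      v0.\<close>
    have "[v0, v1, v4, v2, v3] ! i \<in> [e0, g, e1, e2] ! i \<and>
        [v0, v1, v4, v2, v3] ! (i + 1) \<in> [e0, g, e1, e2] ! i" if "i < 4" for i
    proof -
      have "i = 0 \<or> i = 1 \<or> i = 2 \<or> i = 3" using that by linarith
      then show ?thesis using last_mem path_mem g_mem by (elim disjE) simp_all
    qed
    moreover have "distinct [v0, v1, v4, v2, v3]" "set [v0, v1, v4, v2, v3] \<subseteq> V"
      using dist(1) longestD(5)[OF p] unfolding vs by auto
    moreover have "distinct [e0, g, e1, e2]" "set [e0, g, e1, e2] \<subseteq> E"
      using dist(2) longestD(6)[OF p] g' unfolding es by auto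
    ultimately have path: "berge_path V E [v0, v1, v4, v2, v3] [e0, g, e1, e2]"
      by (simp add: berge_path_def)
    have "v0 \<notin> g" using dist(1) unfolding gh'(1) vs by simp
    then have "h \<noteq> g" using gh'(2) by blast
    moreover have "v0 \<in> h" "v3 \<in> h" using gh'(2) by auto
    moreover have "h \<in> E" "h \<notin> {e0, e1, e2}" using h' unfolding es by simp_all
    ultimately have "closes [v0, v1, v4, v2, v3] [e0, g, e1, e2] h"
      unfolding closes_def longest_def using path k4 by simp
    then show False using no_cycle by blast
  qed
qed

lemma good_set_3_4:
  assumes r3: "r = 3" and k4: "k = 4" and p: "longest vs es"
  shows "\<exists>S. good_set r V E S \<and> card S < card V"
proof (rule ccontr)
  assume none: "\<not> ?thesis"
  have four: "(4::nat) choose 2 = 6" by (simp add: choose_two)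
  have deg: "3 \<le> card {g \<in> E. last us \<in> g}" if q: "longest us fs" for us fs
  proof (rule ccontr)
    assume "\<not> ?thesis"
    moreover have "incident_edges E {last us} = {g \<in> E. last us \<in> g}"
      by (auto simp: incident_edges_def)
    \<comment> \<open>Degree at most 2 makes the singleton good, as
      \<open>3 * 2 \<le> 6 * 1\<close>.\<close>
    ultimately have "r * card (incident_edges E {last us}) \<le> (k choose (r - 1)) * card {last us}"
      using r3 k4 four by simp
    moreover have "{last us} \<subseteq> ends" using q by (auto simp: ends_def)
    ultimately have "good_set r V E {last us}" using good_setI[of "{last us}"] r_le_k by blast
    moreover have "card (set us) \<le> card V"
      using longestD(5)[OF q] finite_V by (intro card_mono)
    then have "card {last us} < card V" using longestD(2,3)[OF q] k4 by (simp add: distinct_card)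
    ultimately show False using none by blast
  qed
  have empty: "last_nbrs us fs = {}" if q: "longest us fs" for us fs
    using last_nbrs_empty_3_4[OF r3 k4 q deg[OF q]] deg[OF longest_rev[OF q]] longestD(9)[OF q]
    by (simp add: last_rev)
  let ?S = "rotation_ends vs es"
  have c: "card {g \<in> E - set es. x \<in> g} \<le> 0" if x: "x \<in> ?S" for x
  proof -
    obtain us fs where q: "longest us fs" "hd us = hd vs" "last us = x" "set fs = set es"
      by (rule rotation_endsE[OF p x])
    show ?thesis using empty[OF q(1)] q(3,4) card_private_edges[of "set es" x] r3 by (simp add: binomial_eq_0)
  qed
  have "card {g \<in> E - set es. last vs \<in> g} = 0"
    using empty[OF p] card_private_edges[of "set es" "last vs"] r3 by (simp add: binomial_eq_0)
  then have S3: "3 \<le> card ?S"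
    using deg[OF p] card_edges_split[OF longestD(6)[OF p], of "last vs"]
    by (simp add: card_rotation_ends[OF p])
  have "card {g \<in> set es. x \<in> g} \<le> card (set es)" for x by (intro card_mono) auto
  then have "card (incident_edges E ?S) \<le> card (set es)"
    using card_incident_edges_le[OF _ finite_E longestD(6)[OF p], of ?S "card (set es)" 0] c
    by (simp add: rotation_ends_def)
  also have "\<dots> \<le> 4" using longestD(1)[OF p] k4 card_length[of es] by simp
  \<comment> \<open>At most four edges meet at least three ends:
    \<open>3 * 4 \<le> 6 * 3\<close>.\<close>
  finally have "r * card (incident_edges E ?S) \<le> (k choose (r - 1)) * card ?S"
    using S3 r3 k4 four by simp
  then have "good_set r V E ?S"
    using rotation_ends_nonempty[OF p] rotation_ends_subset_ends[OF p] r_le_k by (intro good_setI)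
  then show False using none card_rotation_ends_less[OF p] by blast
qed

end

theorem theorem3p9:
  fixes V :: "'a set" and E :: "'a set set" and n r k :: nat
  assumes "uniform_hypergraph r V E"
    and "connected_hypergraph V E"
    and "card V = n"
    and "longest_path_length V E = k"
    and "k > r" and "r \<ge> 3"
  shows "(\<exists>S. good_set r V E S \<and> (card S < n \<or> n = k + 1)) \<and> good_sets r V E \<noteq> {}"
proof -
  let ?L = "{length es |vs es. berge_path V E vs es}"
  have fin: "finite V" using assms(1) by (simp add: uniform_hypergraph_def hypergraph_def)
  have le: "length es \<le> card V" if "berge_path V E vs es" for vs es
  proof -
    have "length vs = card (set vs)" using that by (simp add: berge_path_def distinct_card)
    also have "\<dots> \<le> card V" using that fin by (intro card_mono) (auto simp: berge_path_def)
    finally show ?thesis using berge_path_length[OF that] by simp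
  qed
  have finL: "finite ?L"
    by (rule finite_subset[of _ "{..card V}"]) (use le in blast, simp)
  \<comment> \<open>Without any path the supremum would take its default value 0, against
    \<open>k > r\<close>.\<close>
  have L: "?L \<noteq> {}"
  proof
    assume "?L = {}"
    then have "k = 0" using assms(4) unfolding longest_path_length_def by (simp only: Sup_nat_empty)
    then show False using assms(5) by simp
  qed
  have Max: "Max ?L = k" using assms(4) cSup_eq_Max[OF finL L] by (simp add: longest_path_length_def)
  have bound: "length es \<le> k" if "berge_path V E vs es" for vs es
  proof -
    have "length es \<in> ?L" using that by blast
    from Max_ge[OF finL this] show ?thesis unfolding Max .
  qed
  have "k \<in> ?L" using Max_in[OF finL L] unfolding Max .
  then obtain vs es where path: "berge_path V E vs es" "length es = k"
    unfolding mem_Collect_eq by (elim exE conjE) (rule that, simp_all)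
  interpret longest_berge_paths r V E k
    by unfold_locales (use assms bound in auto)
  have p: "longest vs es" using path by (simp add: longest_def)
  have "\<exists>S. good_set r V E S \<and> (card S < n \<or> n = k + 1)"
  \<comment> \<open>A closed path leads to \<open>n = k + 1\<close>; in its absence the good set is
    a proper subset of \<open>V\<close>.\<close>
  proof (cases "\<exists>vs es g. closes vs es g")
    case True
    then show ?thesis using closes_good assms by (metis less_imp_le)
  next
    case False
    then interpret longest_berge_paths_no_cycle r V E k
      by unfold_locales (use assms in auto)
    have "\<exists>S. good_set r V E S \<and> card S < card V"
    proof (cases "r = 3 \<and> k = 4")
      case True
      then show ?thesis using good_set_3_4 p by blast
    next
      case False
      then show ?thesis using good_set_from_inequality[OF p] binomial_inequality assms by blast
    qed
    then show ?thesis using assms(3) by blast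
  qed
  then show ?thesis by (auto simp: good_sets_def)
qed

end
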